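(* Let $\mathcal H$ be a CNP space on a set $X$ with kernel $k$, let $h:X\to\mathbb C$ be a densely defined multiplier of $\mathcal H$, and let $T$ be the operator of multiplication by $h$. The linear span of the kernel functions $k_x$, $x\in X$ (all of which belong to $\mathrm{Dom}\,T^*$), is dense in $\mathrm{Dom}\,T^*$ with respect to the graph norm $\|f\|_{\mathrm{Dom}\,T^*}^2=\|f\|_{\mathcal H}^2+\|T^*f\|_{\mathcal H}^2$.
   Context: A CNP kernel on a set $X$ is a kernel of the form $k(x,y)=\frac{1}{1-\langle u(x),u(y)\rangle}$ where $u:X\to \ell^2(I)$ is injective and $\|u(x)\|<1$ for all $x$. A CNP space on $X$ is the reproducing kernel Hilbert space $\mathcal H$ on $X$ with such a kernel; $k_x=k(\cdot,x)$ is the reproducing kernel at $x$. A densely defined (unbounded) multiplier of $\mathcal H$ is a function $h:X\to\mathbb C$ for which $\mathrm{Dom}\,T=\{f\in\mathcal H: hf\in\mathcal H\}$ is dense in $\mathcal H$; $T:\mathrm{Dom}\,T\to\mathcal H$, $Tf=hf$, is then a closed densely defined operator, with densely defined adjoint $T^*$. (In the paper $\mathrm{Dom}\,T^*$ with the graph norm is also denoted $\mathcal H(B)$.) *)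

theory Defs
  imports "HOL-Analysis.Analysis" "HOL-Library.Function_Algebras"
begin

text \<open>A function on the set \<open>X\<close> is represented by a function on the ambient type that vanishes
  off \<open>X\<close>.  The pointwise vector space structure over the complex numbers:\<close>

definition fun_scale :: "complex \<Rightarrow> ('x \<Rightarrow> complex) \<Rightarrow> 'x \<Rightarrow> complex" where
  "fun_scale c f = (\<lambda>x. c * f x)"

global_interpretation cfun: vector_space fun_scale
  defines cfun_span = cfun.span
    and cfun_subspace = cfun.subspace
  by standard (auto simp: fun_scale_def fun_eq_iff algebra_simps)

definition ip_norm :: "('v \<Rightarrow> 'v \<Rightarrow> complex) \<Rightarrow> 'v \<Rightarrow> real" where
  "ip_norm ip f = sqrt (Re (ip f f))"

text \<open>Completeness and density are stated with explicit Cauchy sequences and epsilons, since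
  \<^locale>\<open>Metric_space\<close> constrains the distance function on the whole type, whereas an inner
  product is only specified on the carrier \<open>H\<close>.\<close>

definition dense_in_wrt :: "('v \<Rightarrow> real) \<Rightarrow> 'v::minus set \<Rightarrow> 'v set \<Rightarrow> bool" where
  "dense_in_wrt N V D \<longleftrightarrow> D \<subseteq> V \<and> (\<forall>f\<in>V. \<forall>e>0. \<exists>g\<in>D. N (f - g) < e)"

locale hilbert_function_space =
  fixes X :: "'x set"
    and H :: "('x \<Rightarrow> complex) set"
    and ip :: "('x \<Rightarrow> complex) \<Rightarrow> ('x \<Rightarrow> complex) \<Rightarrow> complex"
  assumes zero_off: "\<And>f x. f \<in> H \<Longrightarrow> x \<notin> X \<Longrightarrow> f x = 0"
    and subspace: "cfun_subspace H"
    and ip_add_left: "\<And>f g l. f \<in> H \<Longrightarrow> g \<in> H \<Longrightarrow> l \<in> H \<Longrightarrow> ip (f + g) l = ip f l + ip g l"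
    and ip_scale_left: "\<And>c f g. f \<in> H \<Longrightarrow> g \<in> H \<Longrightarrow> ip (fun_scale c f) g = c * ip f g"
    and ip_cnj: "\<And>f g. f \<in> H \<Longrightarrow> g \<in> H \<Longrightarrow> ip g f = cnj (ip f g)"
    and ip_nonneg: "\<And>f. f \<in> H \<Longrightarrow> 0 \<le> Re (ip f f)"
    and ip_definite: "\<And>f. f \<in> H \<Longrightarrow> ip f f = 0 \<Longrightarrow> f = 0"
    and complete: "\<And>s :: nat \<Rightarrow> 'x \<Rightarrow> complex.
          (\<And>n. s n \<in> H) \<Longrightarrow>
          (\<forall>e>0. \<exists>M. \<forall>m\<ge>M. \<forall>n\<ge>M. ip_norm ip (s m - s n) < e) \<Longrightarrow>
          \<exists>f\<in>H. (\<lambda>n. ip_norm ip (s n - f)) \<longlonglongrightarrow> 0"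

text \<open>The kernel function \<open>k(\<cdot>, x)\<close>, extended by zero off \<open>X\<close>.\<close>

definition kernel_fun :: "'x set \<Rightarrow> ('x \<Rightarrow> 'x \<Rightarrow> complex) \<Rightarrow> 'x \<Rightarrow> 'x \<Rightarrow> complex" where
  "kernel_fun X k x = (\<lambda>y. if y \<in> X then k y x else 0)"

locale rkhs = hilbert_function_space X H ip
  for X :: "'x set" and H :: "('x \<Rightarrow> complex) set"
    and ip :: "('x \<Rightarrow> complex) \<Rightarrow> ('x \<Rightarrow> complex) \<Rightarrow> complex" +
  fixes k :: "'x \<Rightarrow> 'x \<Rightarrow> complex"
  assumes kernel_mem: "\<And>x. x \<in> X \<Longrightarrow> kernel_fun X k x \<in> H"
    and reproducing: "\<And>f x. f \<in> H \<Longrightarrow> x \<in> X \<Longrightarrow> f x = ip f (kernel_fun X k x)"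

text \<open>The sequence space over the index set \<open>I\<close>; only the values on \<open>I\<close> are significant, and
  the inner product is linear in its first argument.\<close>

definition ell2 :: "'i set \<Rightarrow> ('i \<Rightarrow> complex) \<Rightarrow> bool" where
  "ell2 I v \<longleftrightarrow> (\<lambda>i. (cmod (v i))\<^sup>2) summable_on I"

definition ell2_inner :: "'i set \<Rightarrow> ('i \<Rightarrow> complex) \<Rightarrow> ('i \<Rightarrow> complex) \<Rightarrow> complex" where
  "ell2_inner I v w = (\<Sum>\<^sub>\<infinity>i\<in>I. v i * cnj (w i))"

text \<open>The feature map \<open>u\<close> and index set \<open>I\<close> are parameters rather than existentially
  quantified, so that the type of indices stays arbitrary.\<close>

definition cnp_kernel ::
    "'x set \<Rightarrow> 'i set \<Rightarrow> ('x \<Rightarrow> 'i \<Rightarrow> complex) \<Rightarrow> ('x \<Rightarrow> 'x \<Rightarrow> complex) \<Rightarrow> bool" where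
  "cnp_kernel X I u k \<longleftrightarrow>
     (\<forall>x\<in>X. ell2 I (u x) \<and> ip_norm (ell2_inner I) (u x) < 1) \<and>
     inj_on (\<lambda>x. restrict (u x) I) X \<and>
     (\<forall>x\<in>X. \<forall>y\<in>X. k x y = 1 / (1 - ell2_inner I (u x) (u y)))"

locale cnp_space = rkhs X H ip k
  for X :: "'x set" and H :: "('x \<Rightarrow> complex) set"
    and ip :: "('x \<Rightarrow> complex) \<Rightarrow> ('x \<Rightarrow> complex) \<Rightarrow> complex"
    and k :: "'x \<Rightarrow> 'x \<Rightarrow> complex" +
  fixes I :: "'i set" and u :: "'x \<Rightarrow> 'i \<Rightarrow> complex"
  assumes cnp_kernel: "cnp_kernel X I u k"

definition mult_op :: "('x \<Rightarrow> complex) \<Rightarrow> ('x \<Rightarrow> complex) \<Rightarrow> 'x \<Rightarrow> complex" where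
  "mult_op h f = (\<lambda>x. h x * f x)"

definition mult_dom :: "('x \<Rightarrow> complex) set \<Rightarrow> ('x \<Rightarrow> complex) \<Rightarrow> ('x \<Rightarrow> complex) set" where
  "mult_dom H h = {f \<in> H. mult_op h f \<in> H}"

definition densely_defined_multiplier ::
    "('x \<Rightarrow> complex) set \<Rightarrow> (('x \<Rightarrow> complex) \<Rightarrow> ('x \<Rightarrow> complex) \<Rightarrow> complex)
       \<Rightarrow> ('x \<Rightarrow> complex) \<Rightarrow> bool" where
  "densely_defined_multiplier H ip h \<longleftrightarrow> dense_in_wrt (ip_norm ip) H (mult_dom H h)"

text \<open>The adjoint of an unbounded operator \<open>T\<close> with domain \<open>D\<close>; the description below picks a
  unique vector when \<open>D\<close> is dense in \<open>H\<close> and \<open>g\<close> lies in the domain of the adjoint.\<close>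

definition adjoint_dom ::
    "'v set \<Rightarrow> ('v \<Rightarrow> 'v \<Rightarrow> complex) \<Rightarrow> 'v set \<Rightarrow> ('v \<Rightarrow> 'v) \<Rightarrow> 'v set" where
  "adjoint_dom H ip D T = {g \<in> H. \<exists>g'\<in>H. \<forall>f\<in>D. ip (T f) g = ip f g'}"

definition adjoint_op ::
    "'v set \<Rightarrow> ('v \<Rightarrow> 'v \<Rightarrow> complex) \<Rightarrow> 'v set \<Rightarrow> ('v \<Rightarrow> 'v) \<Rightarrow> 'v \<Rightarrow> 'v" where
  "adjoint_op H ip D T g = (THE g'. g' \<in> H \<and> (\<forall>f\<in>D. ip (T f) g = ip f g'))"

definition graph_norm :: "('v \<Rightarrow> 'v \<Rightarrow> complex) \<Rightarrow> ('v \<Rightarrow> 'v) \<Rightarrow> 'v \<Rightarrow> real" where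
  "graph_norm ip A f = sqrt ((ip_norm ip f)\<^sup>2 + (ip_norm ip (A f))\<^sup>2)"

end

theory Submission
  imports Defs
begin

text \<open>Since \<open>T\<^sup>* k\<^sub>x = cnj (h x) k\<^sub>x\<close>, a vector \<open>w\<close> of \<open>Dom T\<^sup>*\<close> that is orthogonal to every
  \<open>k\<^sub>x\<close> in the graph inner product satisfies \<open>w x + h x (T\<^sup>* w) x = 0\<close> for all \<open>x\<close>, that is
  \<open>h T\<^sup>* w = - w\<close>.  As the domain of \<open>T\<close> is maximal, \<open>T\<^sup>* w\<close> lies in it, and
  \<open>\<langle>w, w\<rangle> = - \<langle>T T\<^sup>* w, w\<rangle> = - \<langle>T\<^sup>* w, T\<^sup>* w\<rangle>\<close> forces \<open>w = 0\<close>.  Density follows because \<open>Dom T\<^sup>*\<close>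
  is complete in the graph norm.\<close>

section \<open>Inner product identities, Cauchy-Schwarz and continuity\<close>

context hilbert_function_space
begin

lemma add_mem: "f \<in> H \<Longrightarrow> g \<in> H \<Longrightarrow> f + g \<in> H"
  and diff_mem: "f \<in> H \<Longrightarrow> g \<in> H \<Longrightarrow> f - g \<in> H"
  and scale_mem: "f \<in> H \<Longrightarrow> fun_scale c f \<in> H"
  and zero_mem: "0 \<in> H"
  using subspace by (simp_all add: cfun.subspace_add cfun.subspace_diff cfun.subspace_scale
      cfun.subspace_0)

lemma ip_diff_left:
  assumes "f \<in> H" "g \<in> H" "l \<in> H"
  shows "ip (f - g) l = ip f l - ip g l"
  using ip_add_left[of "f - g" g l] assms diff_mem by simp

lemma ip_add_right:
  assumes "f \<in> H" "g \<in> H" "l \<in> H"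
  shows "ip l (f + g) = ip l f + ip l g"
  using ip_add_left[OF assms] ip_cnj assms add_mem by (metis complex_cnj_add)

lemma ip_diff_right:
  assumes "f \<in> H" "g \<in> H" "l \<in> H"
  shows "ip l (f - g) = ip l f - ip l g"
  using ip_diff_left[OF assms] ip_cnj assms diff_mem by (metis complex_cnj_diff)

lemma ip_scale_right:
  assumes "f \<in> H" "g \<in> H"
  shows "ip f (fun_scale c g) = cnj c * ip f g"
  using ip_scale_left[OF assms(2,1)] ip_cnj assms scale_mem by (metis complex_cnj_mult)

lemma ip_zero_left: "f \<in> H \<Longrightarrow> ip 0 f = 0"
  using ip_diff_left[of f f f] by simp

lemma ip_zero_right: "f \<in> H \<Longrightarrow> ip f 0 = 0"
  using ip_diff_right[of f f f] by simp

lemma ip_norm_nonneg: "f \<in> H \<Longrightarrow> 0 \<le> ip_norm ip f"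
  by (simp add: ip_norm_def ip_nonneg)

lemma ip_norm_power2: "f \<in> H \<Longrightarrow> (ip_norm ip f)\<^sup>2 = Re (ip f f)"
  by (simp add: ip_norm_def ip_nonneg)

lemma ip_self: "f \<in> H \<Longrightarrow> ip f f = of_real ((ip_norm ip f)\<^sup>2)"
  using ip_cnj[of f f] by (simp add: ip_norm_power2 complex_eq_iff)

lemma ip_norm_eq_0: "f \<in> H \<Longrightarrow> ip_norm ip f = 0 \<Longrightarrow> f = 0"
  using ip_self ip_definite by simp

lemma ip_norm_minus_commute:
  assumes "f \<in> H" "g \<in> H"
  shows "ip_norm ip (f - g) = ip_norm ip (g - f)"
  using assms by (simp add: ip_norm_def diff_mem ip_diff_left ip_diff_right)

lemma ip_norm_scale: "f \<in> H \<Longrightarrow> (ip_norm ip (fun_scale c f))\<^sup>2 = (cmod c)\<^sup>2 * (ip_norm ip f)\<^sup>2"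
proof -
  assume f: "f \<in> H"
  then have "ip (fun_scale c f) (fun_scale c f) = of_real ((cmod c)\<^sup>2 * (ip_norm ip f)\<^sup>2)"
    by (simp add: ip_scale_left ip_scale_right scale_mem ip_self[OF f] complex_norm_square
        del: of_real_power)
  then show ?thesis using f by (simp add: ip_norm_power2 scale_mem)
qed

lemma ip_norm_diff_power2:
  assumes "f \<in> H" "g \<in> H"
  shows "(ip_norm ip (f - g))\<^sup>2 = (ip_norm ip f)\<^sup>2 - 2 * Re (ip f g) + (ip_norm ip g)\<^sup>2"
  using assms ip_cnj[of f g]
  by (simp add: ip_norm_power2 diff_mem ip_diff_left ip_diff_right)

lemma ip_norm_add_power2:
  assumes "f \<in> H" "g \<in> H"
  shows "(ip_norm ip (f + g))\<^sup>2 = (ip_norm ip f)\<^sup>2 + 2 * Re (ip f g) + (ip_norm ip g)\<^sup>2"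
  using assms ip_cnj[of f g]
  by (simp add: ip_norm_power2 add_mem ip_add_left ip_add_right)

text \<open>For \<open>d = 0\<close> this is the Cauchy--Schwarz inequality; for \<open>d\<close> the squared distance to a
  subspace it says that almost minimizing vectors are almost orthogonal.\<close>

lemma ip_le_excess:
  assumes f: "f \<in> H" and v: "v \<in> H"
    and d: "\<And>c. d \<le> (ip_norm ip (f - fun_scale c v))\<^sup>2"
  shows "(cmod (ip f v))\<^sup>2 \<le> ((ip_norm ip f)\<^sup>2 - d) * (ip_norm ip v)\<^sup>2"
proof (cases "v = 0")
  case True
  then show ?thesis using f by (simp add: ip_zero_right ip_norm_def ip_zero_left zero_mem)
next
  case False
  define a where "a = ip f v"
  define q where "q = (ip_norm ip v)\<^sup>2"
  have q: "q > 0" using False v ip_norm_eq_0[of v] by (auto simp: q_def)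
  \<comment> \<open>With this \<open>c\<close>, \<open>fun_scale c v\<close> is the orthogonal
    projection of \<open>f\<close> onto the line through \<open>v\<close>; it makes the hypothesis
    on \<open>d\<close> sharpest.\<close>
  define c where "c = a / of_real q"
  have "cnj c * a = of_real ((cmod a)\<^sup>2 / q)"
    by (simp add: c_def complex_norm_square[symmetric] mult.commute[of "cnj a"]
        del: of_real_power)
  then have "Re (ip f (fun_scale c v)) = (cmod a)\<^sup>2 / q"
    using f v by (simp add: ip_scale_right flip: a_def)
  moreover have "(cmod c)\<^sup>2 * q = (cmod a)\<^sup>2 / q"
    using q by (simp add: c_def norm_divide power_divide power2_eq_square)
  ultimately have "d \<le> (ip_norm ip f)\<^sup>2 - (cmod a)\<^sup>2 / q"
    using d[of c] f v by (simp add: ip_norm_diff_power2 scale_mem ip_norm_scale flip: q_def)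
  then have "(cmod a)\<^sup>2 / q \<le> (ip_norm ip f)\<^sup>2 - d" by simp
  then show ?thesis using q by (simp add: divide_le_eq flip: a_def q_def)
qed

lemma cauchy_schwarz:
  assumes "f \<in> H" "g \<in> H"
  shows "cmod (ip f g) \<le> ip_norm ip f * ip_norm ip g"
proof (rule power2_le_imp_le)
  show "(cmod (ip f g))\<^sup>2 \<le> (ip_norm ip f * ip_norm ip g)\<^sup>2"
    using ip_le_excess[OF assms, of 0] by (simp add: power_mult_distrib)
qed (use assms ip_norm_nonneg in simp)

lemma tendsto_ip_left:
  assumes s: "\<And>n. s n \<in> H" and f: "f \<in> H" and g: "g \<in> H"
    and lim: "(\<lambda>n::nat. ip_norm ip (s n - f)) \<longlonglongrightarrow> 0"
  shows "(\<lambda>n. ip (s n) g) \<longlonglongrightarrow> ip f g"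
proof -
  have "(\<lambda>n. ip (s n - f) g) \<longlonglongrightarrow> 0"
  proof (rule Lim_null_comparison)
    show "\<forall>\<^sub>F n in sequentially. cmod (ip (s n - f) g) \<le> ip_norm ip (s n - f) * ip_norm ip g"
      using cauchy_schwarz s f g diff_mem by simp
    show "(\<lambda>n. ip_norm ip (s n - f) * ip_norm ip g) \<longlonglongrightarrow> 0"
      using lim by (rule tendsto_mult_left_zero)
  qed
  then have "(\<lambda>n. ip (s n) g - ip f g) \<longlonglongrightarrow> 0"
    using s f g by (simp add: ip_diff_left)
  then show ?thesis by (rule LIM_zero_cancel)
qed

lemma tendsto_ip_right:
  assumes s: "\<And>n. s n \<in> H" and f: "f \<in> H" and g: "g \<in> H"
    and lim: "(\<lambda>n::nat. ip_norm ip (s n - f)) \<longlonglongrightarrow> 0"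
  shows "(\<lambda>n. ip g (s n)) \<longlonglongrightarrow> ip g f"
proof -
  have "ip g l = cnj (ip l g)" if "l \<in> H" for l
    using ip_cnj that g by blast
  then show ?thesis using tendsto_cnj[OF tendsto_ip_left[OF assms]] s f by simp
qed

section \<open>Minimizing sequences and a density criterion\<close>

text \<open>This is the parallelogram law for \<open>f - v\<close> and \<open>f - w\<close>. Their
  sum is twice \<open>f - m\<close> with \<open>m\<close> the midpoint of \<open>v\<close> and
  \<open>w\<close>; as \<open>m\<close> stays in \<open>V\<close>, the sum has squared norm at least
  \<open>4 * d\<close>. It makes minimizing sequences Cauchy.\<close>

lemma minimizing_sequence_diff:
  assumes f: "f \<in> H" and V: "cfun_subspace V" "V \<subseteq> H" and vw: "v \<in> V" "w \<in> V"
    and d: "\<And>v. v \<in> V \<Longrightarrow> d \<le> (ip_norm ip (f - v))\<^sup>2"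
  shows "(ip_norm ip (v - w))\<^sup>2 \<le> 2 * (ip_norm ip (f - v))\<^sup>2 + 2 * (ip_norm ip (f - w))\<^sup>2 - 4 * d"
proof -
  define m where "m = fun_scale (1/2) (v + w)"
  have m: "m \<in> V" unfolding m_def by (intro cfun.subspace_scale cfun.subspace_add V vw)
  have H: "f - v \<in> H" "f - w \<in> H" "f - m \<in> H" using f V vw m diff_mem by auto
  have "(f - v) + (f - w) = fun_scale 2 (f - m)"
    by (auto simp: m_def fun_scale_def fun_eq_iff algebra_simps)
  then have "(ip_norm ip ((f - v) + (f - w)))\<^sup>2 = 4 * (ip_norm ip (f - m))\<^sup>2"
    using ip_norm_scale[OF H(3), of 2] by simp
  moreover have "(ip_norm ip (v - w))\<^sup>2 = (ip_norm ip ((f - w) - (f - v)))\<^sup>2"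
    by simp
  ultimately show ?thesis
    using d[OF m] ip_norm_add_power2[OF H(1,2)] ip_norm_diff_power2[OF H(2,1)] ip_cnj[OF H(1,2)]
    by simp
qed

text \<open>A sequence in \<open>V\<close> minimizing the distance to \<open>f\<close> converges to
  some \<open>g\<close> in \<open>H\<close>, possibly outside \<open>V\<close>. The difference
  \<open>f - g\<close> is orthogonal to \<open>V\<close>, hence zero, so the sequence itself
  approximates \<open>f\<close>.\<close>

lemma dense_if_orthogonal_trivial:
  assumes V: "cfun_subspace V" "V \<subseteq> H"
    and orth: "\<And>w. w \<in> H \<Longrightarrow> (\<And>v. v \<in> V \<Longrightarrow> ip w v = 0) \<Longrightarrow> w = 0"
  shows "dense_in_wrt (ip_norm ip) H V"
  unfolding dense_in_wrt_def
proof (intro conjI ballI allI impI V)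
  fix f and e :: real
  assume f: "f \<in> H" and e: "e > 0"
  let ?S = "(\<lambda>v. (ip_norm ip (f - v))\<^sup>2) ` V"
  define d where "d = Inf ?S"
  have d: "d \<le> (ip_norm ip (f - v))\<^sup>2" if "v \<in> V" for v
    unfolding d_def using that by (auto intro!: cInf_lower bdd_belowI[of _ 0])
  have "\<exists>v\<in>V. (ip_norm ip (f - v))\<^sup>2 < d + inverse (real (Suc n))" for n
  proof -
    have "?S \<noteq> {}" using cfun.subspace_0[OF V(1)] by auto
    then show ?thesis
      using cInf_lessD[of ?S "d + inverse (real (Suc n))"] by (auto simp: d_def)
  qed
  then obtain s where sV: "\<And>n. s n \<in> V"
    and s: "\<And>n. (ip_norm ip (f - s n))\<^sup>2 < d + inverse (real (Suc n))"
    by metis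
  have sH: "s n \<in> H" for n using sV V by auto
  have "\<exists>M. \<forall>m\<ge>M. \<forall>n\<ge>M. ip_norm ip (s m - s n) < r" if r: "r > 0" for r
  proof -
    \<comment> \<open>The terms in \<open>d\<close> cancel in
      \<open>minimizing_sequence_diff\<close>, leaving two errors of weight 2, each at most
      \<open>inverse (Suc M)\<close>; hence the factor 4.\<close>
    obtain M where M: "inverse (real (Suc M)) < r\<^sup>2 / 4"
      using reals_Archimedean[of "r\<^sup>2 / 4"] r by auto
    have "ip_norm ip (s m - s n) < r" if mn: "m \<ge> M" "n \<ge> M" for m n
    proof (rule power2_less_imp_less)
      have "inverse (real (Suc m)) \<le> inverse (real (Suc M))"
        "inverse (real (Suc n)) \<le> inverse (real (Suc M))"
        using mn by (auto intro!: le_imp_inverse_le)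
      then show "(ip_norm ip (s m - s n))\<^sup>2 < r\<^sup>2"
        using minimizing_sequence_diff[OF f V sV sV d, of m n] s[of m] s[of n] M
        by linarith
    qed (use r in simp)
    then show ?thesis by blast
  qed
  then obtain g where g: "g \<in> H" and lim: "(\<lambda>n. ip_norm ip (s n - g)) \<longlonglongrightarrow> 0"
    using complete[of s] sH by blast
  have "ip (f - g) v = 0" if v: "v \<in> V" for v
  proof -
    have vH: "v \<in> H" using v V by auto
    have bound: "(cmod (ip (f - s n) v))\<^sup>2 \<le> inverse (real (Suc n)) * (ip_norm ip v)\<^sup>2" for n
    proof -
      \<comment> \<open>Moving from \<open>s n\<close> along \<open>v\<close> stays in
        \<open>V\<close>, so \<open>ip_le_excess\<close> applies to \<open>f - s n\<close>, whose
        excess over \<open>d\<close> is below \<open>inverse (Suc n)\<close>.\<close>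
      have "d \<le> (ip_norm ip (f - s n - fun_scale c v))\<^sup>2" for c
        using d[of "s n + fun_scale c v"] V sV v
        by (simp add: cfun.subspace_add cfun.subspace_scale diff_diff_eq)
      then have "(cmod (ip (f - s n) v))\<^sup>2
          \<le> ((ip_norm ip (f - s n))\<^sup>2 - d) * (ip_norm ip v)\<^sup>2"
        by (intro ip_le_excess diff_mem f sH vH)
      also have "\<dots> \<le> inverse (real (Suc n)) * (ip_norm ip v)\<^sup>2"
        using s[of n] by (intro mult_right_mono) auto
      finally show ?thesis .
    qed
    have "(\<lambda>n. (cmod (ip (f - s n) v))\<^sup>2) \<longlonglongrightarrow> 0"
    proof (rule Lim_null_comparison)
      show "\<forall>\<^sub>F n in sequentially. norm ((cmod (ip (f - s n) v))\<^sup>2)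
          \<le> inverse (real (Suc n)) * (ip_norm ip v)\<^sup>2"
        using bound by simp
      show "(\<lambda>n. inverse (real (Suc n)) * (ip_norm ip v)\<^sup>2) \<longlonglongrightarrow> 0"
        by (rule tendsto_mult_left_zero[OF LIMSEQ_inverse_real_of_nat])
    qed
    moreover have "(\<lambda>n. (cmod (ip (f - s n) v))\<^sup>2) \<longlonglongrightarrow> (cmod (ip (f - g) v))\<^sup>2"
      using tendsto_diff[OF tendsto_const tendsto_ip_left[OF sH g vH lim], of "ip f v"]
      by (intro tendsto_intros) (simp add: ip_diff_left f g sH vH)
    ultimately show ?thesis using LIMSEQ_unique by fastforce
  qed
  then have "f - g = 0" using orth diff_mem f g by blast
  then have "(\<lambda>n. ip_norm ip (f - s n)) \<longlonglongrightarrow> 0"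
    using lim ip_norm_minus_commute[OF f sH] by simp
  then obtain n where "ip_norm ip (f - s n) < e"
    using eventually_happens[OF order_tendstoD(2)[OF _ e]] by fastforce
  then show "\<exists>g\<in>V. ip_norm ip (f - g) < e" using sV by blast
qed

text \<open>If \<open>g\<close> were nonzero, some \<open>f\<close> in \<open>D\<close> would be
  closer to \<open>g\<close> than the norm of \<open>g\<close>. Since \<open>f\<close> is orthogonal
  to \<open>g\<close>, the product of \<open>g - f\<close> with \<open>g\<close> is still the
  squared norm of \<open>g\<close>, against Cauchy-Schwarz.\<close>

lemma orthogonal_to_dense:
  assumes D: "dense_in_wrt (ip_norm ip) H D" and g: "g \<in> H"
    and orth: "\<And>f. f \<in> D \<Longrightarrow> ip f g = 0"
  shows "g = 0"
proof (rule ccontr)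
  assume "g \<noteq> 0"
  then have pos: "ip_norm ip g > 0"
    using ip_norm_eq_0[OF g] ip_norm_nonneg[OF g] by linarith
  then obtain f where f: "f \<in> D" "ip_norm ip (g - f) < ip_norm ip g"
    using D g unfolding dense_in_wrt_def by blast
  have fH: "f \<in> H" using D f unfolding dense_in_wrt_def by auto
  have "(ip_norm ip g)\<^sup>2 = cmod (ip (g - f) g)"
    using g fH orth[OF f(1)] by (simp add: ip_diff_left ip_self norm_power)
  also have "\<dots> \<le> ip_norm ip (g - f) * ip_norm ip g"
    using cauchy_schwarz g fH diff_mem by blast
  also have "\<dots> < (ip_norm ip g)\<^sup>2"
    using f(2) pos by (simp add: power2_eq_square)
  finally show False by simp
qed

end

section \<open>The adjoint of a densely defined operator and its graph space\<close>

locale dense_operator = hilbert_function_space X H ip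
  for X :: "'x set" and H :: "('x \<Rightarrow> complex) set"
    and ip :: "('x \<Rightarrow> complex) \<Rightarrow> ('x \<Rightarrow> complex) \<Rightarrow> complex" +
  fixes D :: "('x \<Rightarrow> complex) set" and T :: "('x \<Rightarrow> complex) \<Rightarrow> 'x \<Rightarrow> complex"
  assumes dense_dom: "dense_in_wrt (ip_norm ip) H D"
    and T_mem: "f \<in> D \<Longrightarrow> T f \<in> H"
begin

abbreviation "A_dom \<equiv> adjoint_dom H ip D T"
abbreviation "A \<equiv> adjoint_op H ip D T"

text \<open>Introduced so that the domain of the adjoint becomes a Hilbert function space in its own
  right, with the graph norm as its norm.\<close>

definition graph_ip :: "('x \<Rightarrow> complex) \<Rightarrow> ('x \<Rightarrow> complex) \<Rightarrow> complex" where
  "graph_ip f g = ip f g + ip (A f) (A g)"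

lemma D_mem: "f \<in> D \<Longrightarrow> f \<in> H"
  using dense_dom by (auto simp: dense_in_wrt_def)

text \<open>The difference of two candidates for the adjoint vector is orthogonal to the dense
  domain \<open>D\<close>, so the definite description has a unique solution.\<close>

lemma A_eqI:
  assumes "g' \<in> H" "\<And>f. f \<in> D \<Longrightarrow> ip (T f) g = ip f g'"
  shows "A g = g'"
  unfolding adjoint_op_def
proof (rule the_equality)
  fix l assume l: "l \<in> H \<and> (\<forall>f\<in>D. ip (T f) g = ip f l)"
  then have "l - g' = 0"
    using assms D_mem by (intro orthogonal_to_dense[OF dense_dom] diff_mem)
      (auto simp: ip_diff_right)
  then show "l = g'" by simp
qed (use assms in blast)

lemma A_domI:
  assumes "g \<in> H" "g' \<in> H" "\<And>f. f \<in> D \<Longrightarrow> ip (T f) g = ip f g'"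
  shows "g \<in> A_dom"
  using assms by (auto simp: adjoint_dom_def)

lemma A_dom_mem: "g \<in> A_dom \<Longrightarrow> g \<in> H"
  by (simp add: adjoint_dom_def)

lemma A_mem: "g \<in> A_dom \<Longrightarrow> A g \<in> H"
  using A_eqI by (fastforce simp: adjoint_dom_def)

lemma A_adjoint: "g \<in> A_dom \<Longrightarrow> f \<in> D \<Longrightarrow> ip (T f) g = ip f (A g)"
  using A_eqI by (fastforce simp: adjoint_dom_def)

lemmas A_simps = A_dom_mem A_mem A_adjoint D_mem T_mem

text \<open>Additivity comes from uniqueness: \<open>A f + A g\<close> satisfies the identity that
  characterizes \<open>A (f + g)\<close>. Scaling and differences work the same way.\<close>

lemma A_add:
  assumes "f \<in> A_dom" "g \<in> A_dom"
  shows "f + g \<in> A_dom" "A (f + g) = A f + A g"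
  using assms
  by (auto intro!: A_domI[of _ "A f + A g"] A_eqI simp: A_simps add_mem ip_add_right)

lemma A_scale:
  assumes "f \<in> A_dom"
  shows "fun_scale c f \<in> A_dom" "A (fun_scale c f) = fun_scale c (A f)"
  using assms
  by (auto intro!: A_domI[of _ "fun_scale c (A f)"] A_eqI simp: A_simps scale_mem ip_scale_right)

lemma A_zero: "0 \<in> A_dom"
  by (auto intro!: A_domI[of _ 0] simp: A_simps zero_mem ip_zero_right)

lemma A_diff:
  assumes "f \<in> A_dom" "g \<in> A_dom"
  shows "f - g \<in> A_dom" "A (f - g) = A f - A g"
  using assms
  by (auto intro!: A_domI[of _ "A f - A g"] A_eqI simp: A_simps diff_mem ip_diff_right)

lemma graph_norm_eq: "f \<in> A_dom \<Longrightarrow> graph_norm ip A f = ip_norm graph_ip f"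
  by (simp add: graph_norm_def graph_ip_def ip_norm_power2 A_simps ip_norm_def[of graph_ip])

text \<open>This is closedness of the adjoint. The graph norm dominates the norms of
  \<open>l\<close> and \<open>A l\<close>, so \<open>s n\<close> and \<open>A (s n)\<close> both
  converge in \<open>H\<close>; continuity of \<open>ip\<close> carries the adjoint identity over to
  the two limits.\<close>

lemma A_dom_complete:
  assumes s: "\<And>n::nat. s n \<in> A_dom"
    and cauchy: "\<forall>e>0. \<exists>M. \<forall>m\<ge>M. \<forall>n\<ge>M. graph_norm ip A (s m - s n) < e"
  shows "\<exists>f\<in>A_dom. (\<lambda>n. graph_norm ip A (s n - f)) \<longlonglongrightarrow> 0"
proof -
  have le: "ip_norm ip l \<le> graph_norm ip A l" "ip_norm ip (A l) \<le> graph_norm ip A l"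
    for l
    by (auto simp: graph_norm_def intro: real_le_rsqrt)
  have "\<forall>e>0. \<exists>M. \<forall>m\<ge>M. \<forall>n\<ge>M. ip_norm ip (s m - s n) < e"
    using cauchy le(1) by (meson order_le_less_trans)
  then obtain f where f: "f \<in> H" and lim_f: "(\<lambda>n. ip_norm ip (s n - f)) \<longlonglongrightarrow> 0"
    using complete[of s] s A_dom_mem by blast
  have "\<forall>e>0. \<exists>M. \<forall>m\<ge>M. \<forall>n\<ge>M. ip_norm ip (A (s m) - A (s n)) < e"
    using cauchy le(2) by (metis (no_types, opaque_lifting) order_le_less_trans A_diff(2) s)
  then obtain g where g: "g \<in> H" and lim_g: "(\<lambda>n. ip_norm ip (A (s n) - g)) \<longlonglongrightarrow> 0"
    using complete[of "\<lambda>n. A (s n)"] s A_mem by blast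
  have adj: "ip (T l) f = ip l g" if l: "l \<in> D" for l
  proof (rule LIMSEQ_unique)
    show "(\<lambda>n. ip (T l) (s n)) \<longlonglongrightarrow> ip (T l) f"
      using tendsto_ip_right[OF _ f _ lim_f] s l A_simps by blast
    have "(\<lambda>n. ip l (A (s n))) \<longlonglongrightarrow> ip l g"
      using tendsto_ip_right[OF _ g _ lim_g] s l A_simps by blast
    then show "(\<lambda>n. ip (T l) (s n)) \<longlonglongrightarrow> ip l g"
      using s l by (simp add: A_adjoint)
  qed
  then have fd: "f \<in> A_dom" and Af: "A f = g" using A_domI A_eqI f g by auto
  have "(\<lambda>n. sqrt ((ip_norm ip (s n - f))\<^sup>2 + (ip_norm ip (A (s n) - g))\<^sup>2)) \<longlonglongrightarrow> sqrt (0\<^sup>2 + 0\<^sup>2)"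
    by (intro tendsto_intros lim_f lim_g)
  then have "(\<lambda>n. graph_norm ip A (s n - f)) \<longlonglongrightarrow> 0"
    using s fd by (simp add: graph_norm_def A_diff Af)
  then show ?thesis using fd by blast
qed

text \<open>Makes \<open>dense_if_orthogonal_trivial\<close> available for the graph inner
  product.\<close>

sublocale graph: hilbert_function_space X A_dom graph_ip
proof
  show "cfun_subspace A_dom"
    by (simp add: cfun.subspace_def A_zero A_add A_scale)
  show "f = 0" if f: "f \<in> A_dom" "graph_ip f f = 0" for f
  proof -
    have "Re (ip f f) + Re (ip (A f) (A f)) = 0"
      using f(2) by (simp add: graph_ip_def complex_eq_iff)
    then have "(ip_norm ip f)\<^sup>2 + (ip_norm ip (A f))\<^sup>2 = 0"
      using f(1) by (simp add: ip_norm_power2 A_simps)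
    then show ?thesis using ip_norm_eq_0 A_dom_mem f by (simp add: sum_power2_eq_zero_iff)
  qed
  show "\<exists>f\<in>A_dom. (\<lambda>n. ip_norm graph_ip (s n - f)) \<longlonglongrightarrow> 0"
    if "\<And>n. s n \<in> A_dom"
      "\<forall>e>0. \<exists>M. \<forall>m\<ge>M. \<forall>n\<ge>M. ip_norm graph_ip (s m - s n) < e" for s :: "nat \<Rightarrow> _"
    using A_dom_complete[of s] that by (simp add: A_diff graph_norm_eq cong: bex_cong)
  show "graph_ip g f = cnj (graph_ip f g)" if "f \<in> A_dom" "g \<in> A_dom" for f g
    using that ip_cnj[of f g] ip_cnj[of "A f" "A g"] by (simp add: graph_ip_def A_simps)
qed (auto simp: graph_ip_def A_simps A_add A_scale ip_add_left ip_scale_left zero_off ip_nonneg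
      algebra_simps)

end

section \<open>Kernel functions as eigenvectors of the adjoint, and their density\<close>

theorem proposition3p6:
  fixes X :: "'x set"
    and H :: "('x \<Rightarrow> complex) set"
    and ip :: "('x \<Rightarrow> complex) \<Rightarrow> ('x \<Rightarrow> complex) \<Rightarrow> complex"
    and k :: "'x \<Rightarrow> 'x \<Rightarrow> complex"
    and I :: "'i set"
    and u :: "'x \<Rightarrow> 'i \<Rightarrow> complex"
    and h :: "'x \<Rightarrow> complex"
  assumes "cnp_space X H ip k I u"
    and "densely_defined_multiplier H ip h"
  defines "dom_adj \<equiv> adjoint_dom H ip (mult_dom H h) (mult_op h)"
    and "T_adj \<equiv> adjoint_op H ip (mult_dom H h) (mult_op h)"
  shows "(\<forall>x\<in>X. kernel_fun X k x \<in> dom_adj) \<and>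
         dense_in_wrt (graph_norm ip T_adj) dom_adj (cfun_span (kernel_fun X k ` X))"
proof -
  interpret cnp_space X H ip k I u by fact
  interpret dense_operator X H ip "mult_dom H h" "mult_op h"
    using assms(2) by unfold_locales (auto simp: densely_defined_multiplier_def mult_dom_def)
  have mem: "f \<in> mult_dom H h \<longleftrightarrow> f \<in> H \<and> mult_op h f \<in> H" for f
    by (simp add: mult_dom_def)
  let ?V = "cfun_span (kernel_fun X k ` X)"
  \<comment> \<open>By the reproducing property both sides equal \<open>h x * f x\<close>; the
    conjugate compensates for conjugate linearity of \<open>ip\<close> in its second
    argument.\<close>
  have eigen: "ip (mult_op h f) (kernel_fun X k x) = ip f (fun_scale (cnj (h x)) (kernel_fun X k x))"
    if "f \<in> mult_dom H h" "x \<in> X" for f x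
    using that reproducing[of "mult_op h f" x] reproducing[of f x]
    by (simp add: mult_dom_def ip_scale_right kernel_mem) (simp add: mult_op_def)
  have K: "kernel_fun X k x \<in> A_dom" if "x \<in> X" for x
    using that eigen by (intro A_domI[of _ "fun_scale (cnj (h x)) (kernel_fun X k x)"])
      (auto simp: kernel_mem scale_mem)
  have AK: "A (kernel_fun X k x) = fun_scale (cnj (h x)) (kernel_fun X k x)" if "x \<in> X" for x
    using that eigen by (intro A_eqI) (auto simp: kernel_mem scale_mem)
  have V: "?V \<subseteq> A_dom"
    using K by (intro cfun.span_minimal graph.subspace) auto
  have "dense_in_wrt (ip_norm graph_ip) A_dom ?V"
  proof (rule graph.dense_if_orthogonal_trivial[OF cfun.subspace_span V])
    fix w assume w: "w \<in> A_dom" and orth: "\<And>v. v \<in> ?V \<Longrightarrow> graph_ip w v = 0"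
    have neg: "mult_op h (A w) = fun_scale (- 1) w"
    proof
      fix x
      show "mult_op h (A w) x = fun_scale (- 1) w x"
      proof (cases "x \<in> X")
        case True
        have "w x + h x * A w x = graph_ip w (kernel_fun X k x)"
          using True w
          by (simp add: graph_ip_def AK ip_scale_right kernel_mem A_simps reproducing)
        also have "\<dots> = 0"
          using True by (intro orth cfun.span_base) auto
        finally have "h x * A w x = - w x" by (simp add: add_eq_0_iff)
        then show ?thesis by (simp add: mult_op_def fun_scale_def)
      next
        \<comment> \<open>Off \<open>X\<close> both \<open>w\<close> and \<open>A w\<close> vanish,
          so the two functions agree on the whole ambient type.\<close>
        case False
        then show ?thesis
          using zero_off[OF A_dom_mem[OF w]] zero_off[OF A_mem[OF w]]
          by (simp add: mult_op_def fun_scale_def)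
      qed
    qed
    have "mult_op h (A w) \<in> H"
      unfolding neg by (intro scale_mem A_dom_mem w)
    then have "A w \<in> mult_dom H h"
      using mem A_mem[OF w] by blast
    \<comment> \<open>The adjoint identity is applied to the vector \<open>A w\<close> itself, so
      the two summands of \<open>graph_ip w w\<close> cancel.\<close>
    from A_adjoint[OF w this] have "ip (fun_scale (- 1) w) w = ip (A w) (A w)"
      unfolding neg .
    then have "graph_ip w w = 0"
      using ip_scale_left[of w w "- 1"] A_dom_mem[OF w] unfolding graph_ip_def
      by (metis add.right_inverse mult_minus1)
    then show "w = 0" using graph.ip_definite w by blast
  qed
  \<comment> \<open>The two norms are identified on \<open>A_dom\<close>, which contains
    \<open>f - g\<close> because the span lies in it.\<close>
  moreover have "graph_norm ip A (f - g) = ip_norm graph_ip (f - g)"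
    if "f \<in> A_dom" "g \<in> ?V" for f g
    using that V A_diff(1) graph_norm_eq by blast
  ultimately show ?thesis
    using K unfolding dom_adj_def T_adj_def dense_in_wrt_def by simp
qed

end
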